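(* Let $a>0$ be a constant, let $q\in C(\mathbb{R}^3)$ be real-valued with $q(x)\ge a^2$ for all $x\in\mathbb{R}^3$, and let $f:\mathbb{R}\to\mathbb{R}$ be a smooth function with $f(0)\neq 0$. Put $p(x):=q(x)-a^2$ and $\|p\|:=\sup_{x\in\mathbb{R}^3}|p(x)|$, and for $R>0$ put $M(R):=\max_{|u|\le R}|f(u)|$ and $M_1(R):=\max_{|\xi|\le R}|f'(\xi)|$. Assume that $a$ is sufficiently large in the following sense: there are constants $R>0$ and $\gamma>0$ such that $$\frac{\|p\|R+M(R)}{a^2}\le R\qquad\text{and}\qquad \frac{\|p\|+M_1(R)}{a^2}\le\gamma<1 .$$ Then for every $\varepsilon>0$ the problem $$-\varepsilon^2\Delta u_\varepsilon+q(x)u_\varepsilon=f(u_\varepsilon)\ \text{ in }\mathbb{R}^3,\qquad |u_\varepsilon(\infty)|<\infty,$$ has a solution $u_\varepsilon\in C(\mathbb{R}^3)$ with $u_\varepsilon\not\equiv 0$.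
   Context: Here $C(\mathbb{R}^3)$ denotes the Banach space of continuous, globally bounded functions on $\mathbb{R}^3$ with the sup-norm. The condition $|u_\varepsilon(\infty)|<\infty$ means that $u_\varepsilon$ stays bounded at infinity; for $u_\varepsilon\in C(\mathbb{R}^3)$ it holds automatically. Since $q$ is only continuous, the differential equation is understood in the sense of distributions. *)

theory Defs
  imports "HOL-Analysis.Analysis"
begin

text \<open>Being \<open>k + 1\<close> times continuously differentiable is expressed through the directional
  derivatives \<open>x \<mapsto> D f(x) v\<close>; in finite dimension this is the usual notion.\<close>

primrec Ck :: "nat \<Rightarrow> ('a::euclidean_space \<Rightarrow> real) \<Rightarrow> bool" where
  "Ck 0 f \<longleftrightarrow> continuous_on UNIV f"
| "Ck (Suc k) f \<longleftrightarrow> (\<forall>x. f differentiable (at x)) \<and>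
     (\<forall>v. Ck k (\<lambda>x. frechet_derivative f (at x) v))"

definition smooth :: "('a::euclidean_space \<Rightarrow> real) \<Rightarrow> bool" where
  "smooth f \<longleftrightarrow> (\<forall>k. Ck k f)"

definition test_function :: "('a::euclidean_space \<Rightarrow> real) \<Rightarrow> bool" where
  "test_function \<phi> \<longleftrightarrow> smooth \<phi> \<and> compact (closure {x. \<phi> x \<noteq> 0})"

definition partial :: "'a::euclidean_space \<Rightarrow> ('a \<Rightarrow> real) \<Rightarrow> 'a \<Rightarrow> real" where
  "partial b \<phi> x = frechet_derivative \<phi> (at x) b"

definition laplacian :: "('a::euclidean_space \<Rightarrow> real) \<Rightarrow> 'a \<Rightarrow> real" where
  "laplacian \<phi> x = (\<Sum>b\<in>Basis. partial b (partial b \<phi>) x)"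

text \<open>For continuous \<open>g\<close> and \<open>R > 0\<close> the supremum is attained.\<close>

definition max_abs :: "(real \<Rightarrow> real) \<Rightarrow> real \<Rightarrow> real" where
  "max_abs g R = (SUP u\<in>{-R..R}. \<bar>g u\<bar>)"

text \<open>The equation \<open>-\<epsilon>\<^sup>2 \<Delta>u + q u = f(u)\<close> in the sense of distributions, that is, tested against
  every \<open>\<phi>\<close> in \<open>C\<^sub>c\<^sup>\<infinity>\<close> with the Laplacian moved onto \<open>\<phi>\<close>. For continuous \<open>q\<close>, \<open>f\<close>, \<open>u\<close>
  all three integrands are continuous with compact support, hence integrable.\<close>

definition distributional_solution ::
    "real \<Rightarrow> ('a::euclidean_space \<Rightarrow> real) \<Rightarrow> (real \<Rightarrow> real) \<Rightarrow> ('a \<Rightarrow> real) \<Rightarrow> bool" where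
  "distributional_solution \<epsilon> q f u \<longleftrightarrow> (\<forall>\<phi>. test_function \<phi> \<longrightarrow>
     - \<epsilon>\<^sup>2 * (\<integral>x. u x * laplacian \<phi> x \<partial>lborel) + (\<integral>x. q x * u x * \<phi> x \<partial>lborel)
       = (\<integral>x. f (u x) * \<phi> x \<partial>lborel))"

end

theory Submission
  imports Defs "HOL-Probability.Distributions" "HOL-Real_Asymp.Real_Asymp"
begin

text \<open>With \<open>p = q - a\<^sup>2\<close> and \<open>c = a\<^sup>2 / \<epsilon>\<^sup>2\<close> the problem is the fixed point equation
  \<open>u = (1/a\<^sup>2) N * (f(u) - p u)\<close>, with \<open>*\<close> convolution and \<open>N\<close> equal to \<open>c\<close>
  times the Green function of \<open>c - \<Delta>\<close>. As \<open>N\<close> is a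
  probability measure, the two smallness conditions make the right-hand side a contraction of the
  ball of radius \<open>R\<close>; and \<open>u = 0\<close> is excluded because \<open>f(0) \<noteq> 0\<close>.

  To avoid the singular kernel, \<open>N\<close> is taken as the law of \<open>s Z\<close>, with \<open>Z\<close> standard Gaussian and \<open>s\<close>
  independent of density \<open>c s exp (-c s\<^sup>2/2)\<close> on \<open>s > 0\<close>. Stein's identity
  \<open>E (Z \<bullet> \<nabla>\<phi>(y + s Z)) = s E \<Delta>\<phi>(y + s Z)\<close> turns \<open>E (c s \<phi> - s \<Delta>\<phi>)(y + s Z) exp (-c s\<^sup>2/2)\<close> into the
  \<open>s\<close>-derivative of \<open>- E \<phi>(y + s Z) exp (-c s\<^sup>2/2)\<close>, so \<open>N\<close> maps \<open>\<phi> - \<Delta>\<phi> / c\<close> back to \<open>\<phi>\<close>.\<close>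

section \<open>Stein's identity for the standard normal law on the line\<close>

abbreviation std_normal :: "real measure" where
  "std_normal \<equiv> density lborel std_normal_density"

lemma prob_space_std_normal: "prob_space std_normal"
  by (rule prob_space_normal_density) simp

lemma std_normal_integral:
  fixes f :: "real \<Rightarrow> real"
  assumes [measurable]: "f \<in> borel_measurable borel"
  shows "integral\<^sup>L std_normal f = (\<integral>x. std_normal_density x * f x \<partial>lborel)"
    and "integrable std_normal f \<longleftrightarrow> integrable lborel (\<lambda>x. std_normal_density x * f x)"
  by (auto simp: integral_density integrable_density)

lemma integral_mult_bounded:
  fixes f g :: "'a \<Rightarrow> real"
  assumes "integrable M f" "g \<in> borel_measurable M" "\<And>x. \<bar>g x\<bar> \<le> B"
  shows "integrable M (\<lambda>x. f x * g x)"
proof (rule Bochner_Integration.integrable_bound)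
  show "integrable M (\<lambda>x. B * f x)" using assms by simp
  show "(\<lambda>x. f x * g x) \<in> borel_measurable M" using assms by measurable
  have "\<bar>f x\<bar> * \<bar>g x\<bar> \<le> \<bar>f x\<bar> * \<bar>B\<bar>" for x
    using assms(3)[of x] by (intro mult_left_mono) auto
  then show "AE x in M. norm (f x * g x) \<le> norm (B * f x)"
    by (simp add: abs_mult mult.commute)
qed

text \<open>The normal density \<open>n\<close> satisfies \<open>n' = - x n\<close>, so
  \<open>n g' - x n g\<close> is the derivative of \<open>n g\<close>. As \<open>g\<close> is
  bounded, \<open>n g\<close> tends to 0 at both ends of the line, and the integral of its
  derivative vanishes.\<close>

lemma std_normal_stein:
  fixes g g' :: "real \<Rightarrow> real"
  assumes d: "\<And>x. (g has_real_derivative g' x) (at x)"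
    and c: "continuous_on UNIV g'"
    and B: "\<And>x. \<bar>g x\<bar> \<le> B" and B': "\<And>x. \<bar>g' x\<bar> \<le> B'"
  shows "(\<integral>x. x * g x \<partial>std_normal) = (\<integral>x. g' x \<partial>std_normal)"
proof -
  let ?n = std_normal_density
  have cg: "continuous_on UNIV g"
    using d by (meson DERIV_isCont continuous_at_imp_continuous_on)
  have [measurable]: "g \<in> borel_measurable borel" "g' \<in> borel_measurable borel"
    using cg c by (auto intro: borel_measurable_continuous_onI)
  have i1: "integrable lborel (\<lambda>x. ?n x * g' x)"
    by (intro integral_mult_bounded[where B=B'] B') auto
  have i2: "integrable lborel (\<lambda>x. (?n x * x) * g x)"
    using integrable_std_normal_moment[of 1]
    by (intro integral_mult_bounded[OF _ _ B]) auto
  let ?F = "\<lambda>x. ?n x * g x"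
  let ?f = "\<lambda>x. ?n x * g' x - (?n x * x) * g x"
  have cn: "continuous_on UNIV ?n"
    unfolding std_normal_density_def by (intro continuous_intros) auto
  have dn: "(?n has_real_derivative - (?n x * x)) (at x)" for x
  proof -
    have "((\<lambda>x. exp (- x\<^sup>2 / 2)) has_real_derivative - (exp (- x\<^sup>2 / 2) * x)) (at x)"
      by (auto intro!: derivative_eq_intros)
    from DERIV_cmult[OF this, of "1 / sqrt (2 * pi)"] show ?thesis
      unfolding std_normal_density_def by (simp only: mult.assoc mult_minus_right)
  qed
  have dF: "(?F has_real_derivative ?f x) (at x)" for x
    by (auto intro!: derivative_eq_intros d dn simp: algebra_simps)
  have "(LBINT x=-\<infinity>..\<infinity>. ?f x) = 0 - 0"
  proof (rule interval_integral_FTC_integrable[where F="?F"])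
    show "set_integrable lborel (einterval (-\<infinity>) \<infinity>) ?f"
      using i1 i2 by (simp add: set_integrable_def)
    show "isCont ?f x" for x
    proof -
      have "continuous_on UNIV ?f" by (intro continuous_intros cg c cn)
      then show ?thesis by (simp add: continuous_on_eq_continuous_at)
    qed
    have nz: "((\<lambda>x. ?n x * B) \<longlongrightarrow> 0) at_top" "((\<lambda>x. ?n x * B) \<longlongrightarrow> 0) at_bot"
      unfolding std_normal_density_def by real_asymp+
    have "\<bar>?F x\<bar> \<le> ?n x * B" for x
      using mult_left_mono[OF B[of x], of "?n x"] by (simp add: abs_mult)
    then have "(?F \<longlongrightarrow> 0) at_top" "(?F \<longlongrightarrow> 0) at_bot"
      by (auto intro!: Lim_null_comparison[OF _ nz(1)] Lim_null_comparison[OF _ nz(2)])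
    then show "((?F \<circ> real_of_ereal) \<longlongrightarrow> 0) (at_right (-\<infinity>))"
      "((?F \<circ> real_of_ereal) \<longlongrightarrow> 0) (at_left \<infinity>)"
      by (simp_all add: ereal_tendsto_simps)
  qed (use dF in \<open>auto simp: has_real_derivative_iff_has_vector_derivative\<close>)
  then have "(\<integral>x. ?f x \<partial>lborel) = 0"
    by (simp add: interval_lebesgue_integral_def set_lebesgue_integral_def)
  then have "(\<integral>x. ?n x * g' x \<partial>lborel) = (\<integral>x. ?n x * x * g x \<partial>lborel)"
    using i1 i2 by simp
  then show ?thesis by (simp add: std_normal_integral mult.assoc)
qed

section \<open>The standard Gaussian on a Euclidean space\<close>

text \<open>Written as the image of a product over \<open>Basis\<close>, so that one coordinate can
  be split off by Fubini and treated with the one-dimensional Stein identity.\<close>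

definition std_gaussian :: "'a::euclidean_space measure" where
  "std_gaussian = distr (\<Pi>\<^sub>M b\<in>Basis. std_normal) borel (\<lambda>f. \<Sum>b\<in>Basis. f b *\<^sub>R b)"

lemma sets_std_gaussian [simp, measurable_cong]: "sets std_gaussian = sets borel"
  by (simp add: std_gaussian_def)

interpretation std_normal_product: product_prob_space "\<lambda>_. std_normal" Basis
  by (simp add: product_prob_space_def product_prob_space_axioms_def product_sigma_finite_def
      prob_space_std_normal prob_space_imp_sigma_finite)

interpretation std_gaussian: prob_space "std_gaussian :: 'a::euclidean_space measure"
  unfolding std_gaussian_def
  by (rule std_normal_product.prob_space_distr) measurable

text \<open>Under the product measure the coordinate \<open>f b\<close> has law
  \<open>std_normal\<close>, whose first moment is finite.\<close>

lemma integrable_std_gaussian_inner: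
  fixes b :: "'a::euclidean_space"
  assumes b: "b \<in> Basis"
  shows "integrable std_gaussian (\<lambda>z. z \<bullet> b)"
proof -
  have "integrable std_normal (\<lambda>x. x)"
    using integrable_std_normal_moment[of 1] by (subst std_normal_integral(2)) auto
  moreover have "std_normal = distr (\<Pi>\<^sub>M b\<in>(Basis::'a set). std_normal) std_normal (\<lambda>f. f b)"
    using std_normal_product.PiM_component[OF b] by simp
  ultimately have "integrable (distr (\<Pi>\<^sub>M b\<in>(Basis::'a set). std_normal) std_normal (\<lambda>f. f b)) (\<lambda>x. x)"
    by simp
  then have "integrable (\<Pi>\<^sub>M b\<in>(Basis::'a set). std_normal) (\<lambda>f. f b)"
    by (rule integrable_distr[rotated]) (use b in measurable)
  then show ?thesis
    unfolding std_gaussian_def using b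
    by (subst integrable_distr_eq) (auto simp: inner_sum_left inner_Basis if_distrib cong: if_cong)
qed

text \<open>The chain rule along a line. The direction \<open>v\<close> will be a basis vector in
  Stein's identity, and a Gaussian sample \<open>z\<close> when the radius \<open>s\<close>
  varies.\<close>

lemma frechet_derivative_real_affine:
  fixes g :: "'a::euclidean_space \<Rightarrow> real"
  assumes "g differentiable (at (x + t *\<^sub>R v))"
  shows "((\<lambda>t. g (x + t *\<^sub>R v)) has_real_derivative frechet_derivative g (at (x + t *\<^sub>R v)) v) (at t)"
proof -
  have "(g has_derivative frechet_derivative g (at (x + t *\<^sub>R v))) (at (x + t *\<^sub>R v))"
    using assms by (simp add: frechet_derivative_works)
  moreover have "((\<lambda>t. x + t *\<^sub>R v) has_derivative (\<lambda>h. h *\<^sub>R v)) (at t)"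
    by (auto intro!: derivative_eq_intros)
  ultimately have "((\<lambda>t. g (x + t *\<^sub>R v)) has_derivative
      (\<lambda>h. frechet_derivative g (at (x + t *\<^sub>R v)) (h *\<^sub>R v))) (at t)"
    by (rule has_derivative_compose[rotated])
  then show ?thesis
    using linear_scale[OF linear_frechet_derivative[OF assms]]
    by (simp add: has_field_derivative_def mult.commute[of _ "frechet_derivative _ _ _"] mult_commute_abs)
qed

text \<open>Fubini freezes all coordinates except the one along \<open>b\<close>; on each line in
  direction \<open>b\<close> the claim is the one-dimensional identity.\<close>

lemma std_gaussian_stein:
  fixes g :: "'a::euclidean_space \<Rightarrow> real"
  assumes b: "b \<in> Basis"
    and d: "\<And>x. g differentiable (at x)"
    and c: "continuous_on UNIV (partial b g)"
    and B: "\<And>x. \<bar>g x\<bar> \<le> B" and B': "\<And>x. \<bar>partial b g x\<bar> \<le> B'"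
  shows "(\<integral>z. (z \<bullet> b) * g z \<partial>std_gaussian) = (\<integral>z. partial b g z \<partial>std_gaussian)"
proof -
  let ?I = "Basis - {b}" and ?S = "\<lambda>f :: 'a \<Rightarrow> real. \<Sum>b\<in>Basis. f b *\<^sub>R b"
  have Basis: "Basis = insert b ?I" using b by auto
  have cg: "continuous_on UNIV g"
    using d by (simp add: continuous_at_imp_continuous_on differentiable_imp_continuous_within)
  have [measurable]: "g \<in> borel_measurable borel" "partial b g \<in> borel_measurable borel"
    using cg c by (auto intro: borel_measurable_continuous_onI)
  have int1: "integrable std_gaussian (\<lambda>z. (z \<bullet> b) * g z)"
    by (intro integral_mult_bounded[where B=B] B integrable_std_gaussian_inner b) measurable
  have int2: "integrable std_gaussian (partial b g)"
    by (rule std_gaussian.integrable_const_bound[where B=B']) (use B' in auto)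
  \<comment> \<open>The coordinate along \<open>b\<close> becomes the inner integral. Since
    \<open>b\<close> is not an index of the remaining product, \<open>x\<close> is reset to 0 there,
    and the coordinate \<open>t\<close> enters through \<open>t *\<^sub>R b\<close>.\<close>
  have fold: "(\<integral>z. h z \<partial>std_gaussian) =
      (\<integral>x. (\<integral>t. h (?S (x(b:=0)) + t *\<^sub>R b) \<partial>std_normal) \<partial>(\<Pi>\<^sub>M b\<in>?I. std_normal))"
    if h: "integrable std_gaussian h" for h :: "'a \<Rightarrow> real"
  proof -
    have [measurable]: "h \<in> borel_measurable borel" using h by (auto dest: borel_measurable_integrable)
    have S: "?S (x(b:=t)) = ?S (x(b:=0)) + t *\<^sub>R b" for x t
    proof -
      have "?S (x(b:=t)) = t *\<^sub>R b + (\<Sum>b'\<in>?I. x b' *\<^sub>R b')" for t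
        using b by (subst sum.remove[of _ b]) auto
      from this[of t] this[of 0] show ?thesis by simp
    qed
    have "(\<integral>z. h z \<partial>std_gaussian) = (\<integral>f. h (?S f) \<partial>(\<Pi>\<^sub>M b\<in>Basis. std_normal))"
      unfolding std_gaussian_def by (subst integral_distr) auto
    also have "\<dots> = (\<integral>x. (\<integral>t. h (?S (x(b:=t))) \<partial>std_normal) \<partial>(\<Pi>\<^sub>M b\<in>?I. std_normal))"
    proof -
      have "integrable (\<Pi>\<^sub>M b\<in>insert b ?I. std_normal) (\<lambda>f. h (?S f))"
        using h unfolding std_gaussian_def Basis[symmetric] by (subst (asm) integrable_distr_eq) auto
      from std_normal_product.product_integral_insert[OF _ _ this]
      show ?thesis unfolding Basis[symmetric] by simp
    qed
    also have "\<dots> = (\<integral>x. (\<integral>t. h (?S (x(b:=0)) + t *\<^sub>R b) \<partial>std_normal) \<partial>(\<Pi>\<^sub>M b\<in>?I. std_normal))"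
      by (intro Bochner_Integration.integral_cong refl arg_cong[where f=h] S)
    finally show ?thesis .
  qed
  show ?thesis
    unfolding fold[OF int1] fold[OF int2]
  proof (rule Bochner_Integration.integral_cong[OF refl])
    fix x :: "'a \<Rightarrow> real"
    define w where "w = ?S (x(b:=0))"
    \<comment> \<open>Orthogonality reduces the factor
      \<open>(w + t *\<^sub>R b) \<bullet> b\<close> to \<open>t\<close>, as the one-dimensional
      identity requires.\<close>
    have wb: "w \<bullet> b = 0"
      unfolding w_def inner_sum_left_Basis[OF b] by simp
    have "(\<integral>t. t * g (w + t *\<^sub>R b) \<partial>std_normal) = (\<integral>t. partial b g (w + t *\<^sub>R b) \<partial>std_normal)"
    proof (rule std_normal_stein[OF _ _ B B'])
      show "((\<lambda>t. g (w + t *\<^sub>R b)) has_real_derivative partial b g (w + t *\<^sub>R b)) (at t)" for t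
        unfolding partial_def by (rule frechet_derivative_real_affine[OF d])
      show "continuous_on UNIV (\<lambda>t. partial b g (w + t *\<^sub>R b))"
        by (rule continuous_on_compose2[OF c]) (auto intro!: continuous_intros)
    qed
    then show "(\<integral>t. ((?S (x(b:=0)) + t *\<^sub>R b) \<bullet> b) * g (?S (x(b:=0)) + t *\<^sub>R b) \<partial>std_normal) =
       (\<integral>t. partial b g (?S (x(b:=0)) + t *\<^sub>R b) \<partial>std_normal)"
      unfolding w_def[symmetric] using b wb by (simp add: inner_add_left)
  qed
qed

section \<open>Test functions and their derivatives\<close>

lemma test_function_Ck: "test_function \<phi> \<Longrightarrow> Ck k \<phi>"
  by (simp add: test_function_def smooth_def)

lemma test_function_differentiable: "test_function \<phi> \<Longrightarrow> \<phi> differentiable (at x)"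
  using test_function_Ck[of \<phi> "Suc 0"] by simp

lemma test_function_continuous: "test_function \<phi> \<Longrightarrow> continuous_on UNIV \<phi>"
  using test_function_Ck[of \<phi> 0] by simp

lemma test_function_measurable: "test_function \<phi> \<Longrightarrow> \<phi> \<in> borel_measurable borel"
  by (intro borel_measurable_continuous_onI test_function_continuous)

text \<open>The complement of the closed support is open and \<open>\<phi>\<close> is zero on it, so
  the derivative is zero there too and the support does not grow.\<close>

lemma test_function_partial:
  assumes \<phi>: "test_function \<phi>"
  shows "test_function (partial b \<phi>)"
  unfolding test_function_def
proof
  have eq: "partial b \<phi> = (\<lambda>x. frechet_derivative \<phi> (at x) b)"
    by (simp add: partial_def fun_eq_iff)
  show "smooth (partial b \<phi>)"
    unfolding smooth_def eq using test_function_Ck[OF \<phi>, of "Suc _"] by simp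
  let ?K = "closure {x. \<phi> x \<noteq> 0}"
  have "partial b \<phi> x = 0" if x: "x \<notin> ?K" for x
  proof -
    have "(\<phi> has_derivative (\<lambda>_. 0)) (at x)"
    proof (rule has_derivative_transform_within_open)
      show "((\<lambda>_. 0) has_derivative (\<lambda>_. 0 :: real)) (at x)" by simp
      show "open (- ?K)" "x \<in> - ?K" using x by auto
      show "0 = \<phi> y" if "y \<in> - ?K" for y
        using that closure_subset[of "{x. \<phi> x \<noteq> 0}"] by auto
    qed
    then show ?thesis
      unfolding partial_def by (simp flip: frechet_derivative_at)
  qed
  then have "{x. partial b \<phi> x \<noteq> 0} \<subseteq> ?K" by auto
  then have "closure {x. partial b \<phi> x \<noteq> 0} \<subseteq> ?K" by (intro closure_minimal) auto
  moreover have "compact ?K" using \<phi> by (simp add: test_function_def)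
  ultimately show "compact (closure {x. partial b \<phi> x \<noteq> 0})"
    by (metis closed_closure compact_Int_closed inf.absorb_iff2)
qed

lemma test_function_bounded:
  assumes \<phi>: "test_function \<phi>"
  obtains B where "\<And>x. \<bar>\<phi> x\<bar> \<le> B"
proof -
  let ?K = "closure {x. \<phi> x \<noteq> 0}"
  have "compact (\<phi> ` ?K)"
    using \<phi> test_function_continuous[OF \<phi>]
    by (intro compact_continuous_image) (auto simp: test_function_def intro: continuous_on_subset)
  then obtain B where B: "B > 0" "\<And>x. x \<in> ?K \<Longrightarrow> norm (\<phi> x) \<le> B"
    by (metis bounded_pos compact_imp_bounded image_eqI)
  have "\<bar>\<phi> x\<bar> \<le> B" for x
    using B closure_subset[of "{x. \<phi> x \<noteq> 0}"] by (cases "\<phi> x = 0") auto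
  then show ?thesis by (rule that)
qed

lemma test_function_integrable:
  assumes \<phi>: "test_function \<phi>"
  shows "integrable lborel \<phi>"
proof -
  let ?K = "closure {x. \<phi> x \<noteq> 0}"
  have "integrable lborel (\<lambda>x. indicator ?K x *\<^sub>R \<phi> x)"
    using \<phi> test_function_continuous[OF \<phi>]
    by (intro borel_integrable_compact) (auto simp: test_function_def intro: continuous_on_subset)
  moreover have "(\<lambda>x. indicator ?K x *\<^sub>R \<phi> x) = \<phi>"
    using closure_subset[of "{x. \<phi> x \<noteq> 0}"] by (auto simp: indicator_def fun_eq_iff)
  ultimately show ?thesis by (simp only:)
qed

text \<open>Rewrites the \<open>s\<close>-derivative of \<open>\<phi> (y + s *\<^sub>R z)\<close> as
  a sum over coordinates, which Stein's identity handles term by term.\<close>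

lemma frechet_derivative_partial:
  assumes "\<phi> differentiable (at x)"
  shows "frechet_derivative \<phi> (at x) z = (\<Sum>b\<in>Basis. (z \<bullet> b) * partial b \<phi> x)"
proof -
  have lin: "linear (frechet_derivative \<phi> (at x))"
    by (rule linear_frechet_derivative[OF assms])
  have "frechet_derivative \<phi> (at x) z = frechet_derivative \<phi> (at x) (\<Sum>b\<in>Basis. (z \<bullet> b) *\<^sub>R b)"
    by (simp add: euclidean_representation)
  also have "\<dots> = (\<Sum>b\<in>Basis. (z \<bullet> b) * partial b \<phi> x)"
    by (simp add: linear_sum[OF lin] linear_scale[OF lin] partial_def)
  finally show ?thesis .
qed

section \<open>Stein's identity for translated and rescaled test functions\<close>

lemma partial_affine:
  assumes "g differentiable (at (y + s *\<^sub>R z))"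
  shows "(\<lambda>z. g (y + s *\<^sub>R z)) differentiable (at z)"
    and "partial b (\<lambda>z. g (y + s *\<^sub>R z)) z = s * partial b g (y + s *\<^sub>R z)"
proof -
  let ?D = "frechet_derivative g (at (y + s *\<^sub>R z))"
  have "((\<lambda>z. y + s *\<^sub>R z) has_derivative (\<lambda>h. s *\<^sub>R h)) (at z)"
    by (auto intro!: derivative_eq_intros)
  moreover have "(g has_derivative ?D) (at (y + s *\<^sub>R z))"
    using assms by (simp add: frechet_derivative_works)
  ultimately have D: "((\<lambda>z. g (y + s *\<^sub>R z)) has_derivative (\<lambda>h. ?D (s *\<^sub>R h))) (at z)"
    by (rule has_derivative_compose)
  then show "(\<lambda>z. g (y + s *\<^sub>R z)) differentiable (at z)"
    by (auto simp: differentiable_def)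
  show "partial b (\<lambda>z. g (y + s *\<^sub>R z)) z = s * partial b g (y + s *\<^sub>R z)"
    unfolding partial_def using linear_scale[OF linear_frechet_derivative[OF assms]]
    by (simp flip: frechet_derivative_at[OF D])
qed

text \<open>Stein's identity for the function
  \<open>\<lambda>z. partial b \<phi> (y + s *\<^sub>R z)\<close>, where the chain rule supplies the
  factor \<open>s\<close>. Summed over \<open>b\<close>, it trades \<open>s\<close> times the
  Laplacian for the derivative of \<open>\<phi>\<close> in direction \<open>z\<close>.\<close>

lemma std_gaussian_stein_affine:
  fixes \<phi> :: "'a::euclidean_space \<Rightarrow> real"
  assumes \<phi>: "test_function \<phi>" and b: "b \<in> Basis"
  shows "(\<integral>z. (z \<bullet> b) * partial b \<phi> (y + s *\<^sub>R z) \<partial>std_gaussian)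
    = (\<integral>z. s * partial b (partial b \<phi>) (y + s *\<^sub>R z) \<partial>std_gaussian)"
proof -
  note p1 = test_function_partial[OF \<phi>, of b] and p2 = test_function_partial[OF test_function_partial[OF \<phi>], of b b]
  obtain B B' where B: "\<And>x. \<bar>partial b \<phi> x\<bar> \<le> B" and B': "\<And>x. \<bar>partial b (partial b \<phi>) x\<bar> \<le> B'"
    using test_function_bounded[OF p1] test_function_bounded[OF p2] by metis
  let ?g = "\<lambda>z. partial b \<phi> (y + s *\<^sub>R z)"
  have eq: "partial b ?g = (\<lambda>z. s * partial b (partial b \<phi>) (y + s *\<^sub>R z))"
    using partial_affine(2)[OF test_function_differentiable[OF p1]] by blast
  have "(\<integral>z. (z \<bullet> b) * ?g z \<partial>std_gaussian) = (\<integral>z. partial b ?g z \<partial>std_gaussian)"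
  proof (rule std_gaussian_stein[OF b _ _ B])
    show "?g differentiable (at z)" for z
      using partial_affine(1)[OF test_function_differentiable[OF p1]] by blast
    show "continuous_on UNIV (partial b ?g)"
      unfolding eq
      by (intro continuous_intros continuous_on_compose2[OF test_function_continuous[OF p2]]) auto
    show "\<bar>partial b ?g z\<bar> \<le> \<bar>s\<bar> * B'" for z
      unfolding eq abs_mult by (intro mult_left_mono B') auto
  qed
  then show ?thesis unfolding eq .
qed

section \<open>Gaussian weights in the radial variable\<close>

text \<open>Up to a constant the weight is the normal density with mean 0 and variance
  \<open>1 / c\<close>, which has finite moments of every order.\<close>

lemma integrable_gaussian_moment:
  fixes c :: real
  assumes "c > 0"
  shows "integrable lborel (\<lambda>s. exp (- (c * s\<^sup>2 / 2)) * s ^ k)"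
proof -
  let ?C = "sqrt (2 * pi / c)"
  have "normal_density 0 (1 / sqrt c) s = exp (- (c * s\<^sup>2 / 2)) / ?C" for s
    using assms by (simp add: normal_density_def power_divide field_simps)
  then have "exp (- (c * s\<^sup>2 / 2)) * s ^ k = ?C * (normal_density 0 (1 / sqrt c) s * (s - 0) ^ k)" for s
    using assms by simp
  moreover have "integrable lborel (\<lambda>s. ?C * (normal_density 0 (1 / sqrt c) s * (s - 0) ^ k))"
    using assms by (intro integrable_mult_right integrable_normal_moment) auto
  ultimately show ?thesis by presburger
qed

text \<open>The weighted integrand is the derivative of
  \<open>- exp (- (c * s\<^sup>2 / 2)) * g s\<close>, which tends to 0 at infinity and equals
  \<open>- g 0\<close> at 0. The constant \<open>g = 1\<close> will give the total mass of the
  radial law, and \<open>g\<close> equal to \<open>\<phi>\<close> along a ray will recover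
  \<open>\<phi>\<close> at the origin of the ray.\<close>

lemma integral_half_line_gaussian:
  fixes g g' :: "real \<Rightarrow> real"
  assumes c: "c > 0"
    and d: "\<And>s. (g has_real_derivative g' s) (at s)"
    and cg': "continuous_on UNIV g'"
    and B: "\<And>s. \<bar>g s\<bar> \<le> B" and B': "\<And>s. \<bar>g' s\<bar> \<le> B'"
  shows "integrable lborel (\<lambda>s. indicator {0<..} s * exp (- (c * s\<^sup>2 / 2)) * (c * s * g s - g' s))"
    and "(\<integral>s. indicator {0<..} s * exp (- (c * s\<^sup>2 / 2)) * (c * s * g s - g' s) \<partial>lborel) = g 0"
proof -
  let ?e = "\<lambda>s. exp (- (c * s\<^sup>2 / 2))"
  have cg: "continuous_on UNIV g"
    using d by (meson DERIV_isCont continuous_at_imp_continuous_on)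
  have [measurable]: "g \<in> borel_measurable borel" "g' \<in> borel_measurable borel"
    using cg cg' by (auto intro: borel_measurable_continuous_onI)
  let ?f = "\<lambda>s. ?e s * (c * s * g s - g' s)"
  \<comment> \<open>The powers \<open>s ^ 1\<close> and \<open>s ^ 0\<close> exhibit each term as a
    Gaussian moment integrand times a bounded function.\<close>
  have "integrable lborel (\<lambda>s. c * ((?e s * s ^ 1) * g s) - (?e s * s ^ 0) * g' s)"
    by (intro Bochner_Integration.integrable_diff integrable_mult_right
        integral_mult_bounded[OF integrable_gaussian_moment[OF c] _ B]
        integral_mult_bounded[OF integrable_gaussian_moment[OF c] _ B']) measurable
  then have int: "integrable lborel ?f" by (simp add: algebra_simps)
  then have "integrable lborel (\<lambda>s. indicator {0<..} s *\<^sub>R ?f s)"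
    by (rule integrable_mult_indicator[rotated]) simp
  then show "integrable lborel (\<lambda>s. indicator {0<..} s * ?e s * (c * s * g s - g' s))"
    by (simp add: mult.assoc)
  let ?F = "\<lambda>s. - (?e s * g s)"
  have dF: "(?F has_real_derivative ?f s) (at s)" for s
    by (auto intro!: derivative_eq_intros d simp: field_simps power2_eq_square)
  have "(LBINT s=0..\<infinity>. ?f s) = 0 - (- g 0)"
  proof (rule interval_integral_FTC_integrable[where F="?F"])
    show "set_integrable lborel (einterval 0 \<infinity>) ?f"
      unfolding set_integrable_def by (intro integrable_mult_indicator int) simp
    show "isCont ?f s" for s
    proof -
      have "continuous_on UNIV ?f" by (intro continuous_intros cg cg') auto
      then show ?thesis by (simp add: continuous_on_eq_continuous_at)
    qed
    have nz: "((\<lambda>s. ?e s * B) \<longlongrightarrow> 0) at_top"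
      using c by real_asymp
    have "\<bar>?F s\<bar> \<le> ?e s * B" for s
      using mult_left_mono[OF B[of s], of "?e s"] by (simp add: abs_mult)
    then have "(?F \<longlongrightarrow> 0) at_top"
      by (auto intro!: Lim_null_comparison[OF _ nz])
    then show "((?F \<circ> real_of_ereal) \<longlongrightarrow> 0) (at_left \<infinity>)"
      by (simp add: ereal_tendsto_simps)
    have "isCont ?F 0" using dF by (rule DERIV_isCont)
    then have "(?F \<longlongrightarrow> - g 0) (at_right 0)"
      by (auto simp: isCont_def intro: tendsto_within_subset[of _ _ _ UNIV])
    then show "((?F \<circ> real_of_ereal) \<longlongrightarrow> - g 0) (at_right 0)"
      unfolding zero_ereal_def by (simp only: ereal_tendsto_simps)
  qed (use dF in \<open>auto simp: has_real_derivative_iff_has_vector_derivative\<close>)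
  moreover have "einterval 0 \<infinity> = {0<..}"
    by (auto simp: einterval_def)
  ultimately show "(\<integral>s. indicator {0<..} s * ?e s * (c * s * g s - g' s) \<partial>lborel) = g 0"
    by (simp add: interval_lebesgue_integral_def set_lebesgue_integral_def mult.assoc)
qed


section \<open>The resolvent law and its action on test functions\<close>

lemma (in pair_sigma_finite) integrable_product_mult:
  fixes f :: "'a \<Rightarrow> real" and g :: "'b \<Rightarrow> real"
  assumes f: "integrable M1 f" and g: "integrable M2 g"
  shows "integrable (M1 \<Otimes>\<^sub>M M2) (\<lambda>x. f (fst x) * g (snd x))"
proof (rule Fubini_integrable)
  have [measurable]: "f \<in> borel_measurable M1" "g \<in> borel_measurable M2" using f g by auto
  show "(\<lambda>x. f (fst x) * g (snd x)) \<in> borel_measurable (M1 \<Otimes>\<^sub>M M2)" by measurable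
  show "integrable M1 (\<lambda>x. \<integral>y. norm (f (fst (x, y)) * g (snd (x, y))) \<partial>M2)"
    using f by (simp add: abs_mult)
  show "AE x in M1. integrable M2 (\<lambda>y. f (fst (x, y)) * g (snd (x, y)))"
    using g by simp
qed

text \<open>The Rayleigh law with scale \<open>1 / sqrt c\<close>, for \<open>c > 0\<close>. Under
  it \<open>t = s\<^sup>2 / 2\<close> is exponential of rate \<open>c\<close>, and for fixed
  \<open>s\<close> the law of \<open>s Z\<close> is the heat kernel of \<Delta> at time
  \<open>t\<close>; mixing over \<open>s\<close> therefore gives \<open>c\<close> times the Laplace
  transform at \<open>c\<close> of the heat semigroup, which is the resolvent.\<close>

definition radial_law :: "real \<Rightarrow> real measure" where
  "radial_law c = density lborel (\<lambda>s. indicator {0<..} s * exp (- (c * s\<^sup>2 / 2)) * (c * s))"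

lemma radial_density_nonneg:
  "c > 0 \<Longrightarrow> 0 \<le> indicator {0<..} s * exp (- (c * s\<^sup>2 / 2)) * (c * s)" for c :: real
  by (simp add: indicator_def)

lemma prob_space_radial_law:
  assumes c: "c > 0"
  shows "prob_space (radial_law c)"
proof
  let ?w = "\<lambda>s. indicator {0<..} s * exp (- (c * s\<^sup>2 / 2)) * (c * s)"
  \<comment> \<open>The half-line formula for \<open>g = 1\<close>, whose value at 0 is the total
    mass.\<close>
  have "integrable lborel ?w" "(\<integral>s. ?w s \<partial>lborel) = 1"
    using integral_half_line_gaussian[OF c, of "\<lambda>_. 1" "\<lambda>_. 0" 1 0] by auto
  then have "(\<integral>\<^sup>+s. ?w s \<partial>lborel) = 1"
    using nn_integral_eq_integral[of lborel ?w] radial_density_nonneg[OF c] by simp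
  then show "emeasure (radial_law c) (space (radial_law c)) = 1"
    by (simp add: radial_law_def emeasure_density)
qed

text \<open>In three dimensions the density is \<open>c exp (-\<surd>c |x|) / (4 \<pi> |x|)\<close>.\<close>

definition resolvent_law :: "real \<Rightarrow> 'a::euclidean_space measure" where
  "resolvent_law c = distr (radial_law c \<Otimes>\<^sub>M std_gaussian) borel (\<lambda>x. fst x *\<^sub>R snd x)"

lemma sets_radial_law [simp, measurable_cong]: "sets (radial_law c) = sets borel"
  by (simp add: radial_law_def)

lemma sets_resolvent_law [simp, measurable_cong]: "sets (resolvent_law c) = sets borel"
  by (simp add: resolvent_law_def)

lemma prob_space_resolvent_law:
  assumes "c > 0"
  shows "prob_space (resolvent_law c :: 'a::euclidean_space measure)"
proof -
  interpret R: prob_space "radial_law c" by (rule prob_space_radial_law[OF assms])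
  interpret P: pair_prob_space "radial_law c" "std_gaussian :: 'a measure" ..
  show ?thesis
    unfolding resolvent_law_def by (rule P.prob_space_distr) measurable
qed

lemma laplacian_bounded:
  assumes "test_function \<phi>"
  obtains B where "\<And>x. \<bar>laplacian \<phi> x\<bar> \<le> B"
proof -
  have "\<exists>B. \<forall>x. \<bar>partial b (partial b \<phi>) x\<bar> \<le> B" for b
    using test_function_bounded[OF test_function_partial[OF test_function_partial[OF assms]]] by metis
  then obtain B where B: "\<And>b x. \<bar>partial b (partial b \<phi>) x\<bar> \<le> B b" by metis
  have "\<bar>laplacian \<phi> x\<bar> \<le> (\<Sum>b\<in>Basis. B b)" for x
    unfolding laplacian_def by (rule sum_abs[THEN order_trans]) (intro sum_mono B)
  then show ?thesis by (rule that)
qed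

lemma laplacian_measurable:
  assumes "test_function \<phi>"
  shows "laplacian \<phi> \<in> borel_measurable borel"
  unfolding laplacian_def[abs_def]
  by (intro borel_measurable_sum test_function_measurable test_function_partial assms)

lemma laplacian_integrable:
  assumes "test_function \<phi>"
  shows "integrable lborel (laplacian \<phi>)"
  unfolding laplacian_def[abs_def]
  by (intro Bochner_Integration.integrable_sum test_function_integrable test_function_partial assms)

text \<open>For each fixed \<open>s\<close>, Stein's identity summed over the basis replaces
  \<open>s * laplacian \<phi>\<close> by the \<open>s\<close>-derivative of
  \<open>\<phi> (y + s *\<^sub>R z)\<close>. The result has the shape that the half-line formula
  integrates in \<open>s\<close>.\<close>

lemma integral_gaussian_resolvent:
  fixes \<phi> :: "'a::euclidean_space \<Rightarrow> real"
  assumes \<phi>: "test_function \<phi>" and c: "c > 0"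
  shows "(c * s) * (\<integral>z. \<phi> (y + s *\<^sub>R z) - laplacian \<phi> (y + s *\<^sub>R z) / c \<partial>std_gaussian)
    = (\<integral>z. c * s * \<phi> (y + s *\<^sub>R z) - (\<Sum>b\<in>Basis. (z \<bullet> b) * partial b \<phi> (y + s *\<^sub>R z)) \<partial>std_gaussian)"
proof -
  have meas [measurable]: "h \<in> borel_measurable borel \<Longrightarrow> (\<lambda>z. h (y + s *\<^sub>R z)) \<in> borel_measurable std_gaussian" for h :: "'a \<Rightarrow> real"
    by (rule measurable_compose[of "\<lambda>z. y + s *\<^sub>R z" _ borel]) measurable
  have int: "integrable std_gaussian (\<lambda>z. \<psi> (y + s *\<^sub>R z))" if \<psi>: "test_function \<psi>" for \<psi> :: "'a \<Rightarrow> real"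
  proof -
    obtain B where "\<And>x. \<bar>\<psi> x\<bar> \<le> B" using test_function_bounded[OF \<psi>] by metis
    then show ?thesis
      by (intro std_gaussian.integrable_const_bound[where B=B] meas test_function_measurable[OF \<psi>]) auto
  qed
  have int_lap: "integrable std_gaussian (\<lambda>z. laplacian \<phi> (y + s *\<^sub>R z))"
    unfolding laplacian_def by (intro Bochner_Integration.integrable_sum int test_function_partial \<phi>)
  have int_inner: "integrable std_gaussian (\<lambda>z. (z \<bullet> b) * partial b \<phi> (y + s *\<^sub>R z))" if b: "b \<in> Basis" for b
  proof -
    obtain B where "\<And>x. \<bar>partial b \<phi> x\<bar> \<le> B"
      using test_function_bounded[OF test_function_partial[OF \<phi>]] by metis
    then show ?thesis
      by (intro integral_mult_bounded[where B=B] integrable_std_gaussian_inner b meas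
          test_function_measurable test_function_partial \<phi>)
  qed
  have lap: "(\<integral>z. s * laplacian \<phi> (y + s *\<^sub>R z) \<partial>std_gaussian)
      = (\<integral>z. (\<Sum>b\<in>Basis. (z \<bullet> b) * partial b \<phi> (y + s *\<^sub>R z)) \<partial>std_gaussian)"
    using int_inner std_gaussian_stein_affine[OF \<phi>]
    by (simp add: laplacian_def sum_distrib_left Bochner_Integration.integral_sum int test_function_partial \<phi>)
  have "(c * s) * (\<integral>z. \<phi> (y + s *\<^sub>R z) - laplacian \<phi> (y + s *\<^sub>R z) / c \<partial>std_gaussian)
      = (\<integral>z. c * s * \<phi> (y + s *\<^sub>R z) - s * laplacian \<phi> (y + s *\<^sub>R z) \<partial>std_gaussian)"
    unfolding integral_mult_right_zero[symmetric]
    using c by (intro Bochner_Integration.integral_cong refl) (simp add: field_simps)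
  also have "\<dots> = (\<integral>z. c * s * \<phi> (y + s *\<^sub>R z) \<partial>std_gaussian) - (\<integral>z. s * laplacian \<phi> (y + s *\<^sub>R z) \<partial>std_gaussian)"
    by (intro Bochner_Integration.integral_diff integrable_mult_right int int_lap \<phi>)
  also have "\<dots> = (\<integral>z. c * s * \<phi> (y + s *\<^sub>R z) - (\<Sum>b\<in>Basis. (z \<bullet> b) * partial b \<phi> (y + s *\<^sub>R z)) \<partial>std_gaussian)"
    unfolding lap
    by (intro Bochner_Integration.integral_diff[symmetric] integrable_mult_right int \<phi>
        Bochner_Integration.integrable_sum int_inner)
  finally show ?thesis .
qed

text \<open>This is the statement that the law inverts \<open>1 - \<Delta> / c\<close> on test
  functions. Stein's identity is applied with the Gaussian integral inside, then Fubini brings the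
  radial integral inside, where the fundamental theorem of calculus evaluates it.\<close>

lemma integral_resolvent_law:
  fixes \<phi> :: "'a::euclidean_space \<Rightarrow> real"
  assumes \<phi>: "test_function \<phi>" and c: "c > 0"
  shows "(\<integral>x. \<phi> (y + x) - laplacian \<phi> (y + x) / c \<partial>resolvent_law c) = \<phi> y"
proof -
  interpret R: prob_space "radial_law c" by (rule prob_space_radial_law[OF c])
  interpret P: pair_prob_space "radial_law c" "std_gaussian :: 'a measure" ..
  interpret L: pair_sigma_finite "lborel :: real measure" "std_gaussian :: 'a measure" ..
  note [measurable] = test_function_measurable[OF \<phi>] laplacian_measurable[OF \<phi>]
    test_function_measurable[OF test_function_partial[OF \<phi>]]
  let ?\<psi> = "\<lambda>x. \<phi> x - laplacian \<phi> x / c"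
  \<comment> \<open>The factor \<open>c * s\<close> of the radial density is left out of
    \<open>?e\<close>: it is the factor that \<open>integral_gaussian_resolvent\<close>
    absorbs.\<close>
  let ?e = "\<lambda>s :: real. indicator {0<..} s * exp (- (c * s\<^sup>2 / 2))"
  let ?D = "\<lambda>x z. \<Sum>b\<in>Basis. (z \<bullet> b) * partial b \<phi> x"
  let ?H = "\<lambda>s z. ?e s * (c * s * \<phi> (y + s *\<^sub>R z) - ?D (y + s *\<^sub>R z) z)"
  obtain B where B: "\<And>x. \<bar>\<phi> x\<bar> \<le> B" using test_function_bounded[OF \<phi>] by metis
  have "\<exists>B. \<forall>x. \<bar>partial b \<phi> x\<bar> \<le> B" for b
    using test_function_bounded[OF test_function_partial[OF \<phi>]] by metis
  then obtain B' where B': "\<And>b x. \<bar>partial b \<phi> x\<bar> \<le> B' b" by metis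
  obtain Bl where Bl: "\<And>x. \<bar>laplacian \<phi> x\<bar> \<le> Bl" using laplacian_bounded[OF \<phi>] by metis
  have B\<psi>: "\<bar>?\<psi> x\<bar> \<le> B + Bl / c" for x
    using B[of x] Bl[of x] c
    by (intro order_trans[OF abs_triangle_ineq4] add_mono) (auto simp: divide_right_mono)
  \<comment> \<open>Each term is an integrable function of \<open>s\<close>, times an integrable
    function of \<open>z\<close> (the constant 1 or a coordinate), times a bounded factor coming
    from \<open>\<phi>\<close>.\<close>
  have intH: "integrable (lborel \<Otimes>\<^sub>M std_gaussian) (\<lambda>(s, z). ?H s z)"
  proof -
    have e: "integrable lborel (\<lambda>s. ?e s * s ^ k)" for k
      using integrable_mult_indicator[OF _ integrable_gaussian_moment[OF c, of k], of "{0<..}"]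
      by (simp add: mult.assoc)
    have 1: "integrable (lborel \<Otimes>\<^sub>M std_gaussian)
        (\<lambda>x. ((?e (fst x) * fst x ^ 1) * 1) * \<phi> (y + fst x *\<^sub>R (snd x :: 'a)))"
      by (intro integral_mult_bounded[OF L.integrable_product_mult[OF e] _ B]) auto
    have 2: "integrable (lborel \<Otimes>\<^sub>M std_gaussian)
        (\<lambda>x. ((?e (fst x) * fst x ^ 0) * (snd x \<bullet> b)) * partial b \<phi> (y + fst x *\<^sub>R snd x))"
      if b: "b \<in> Basis" for b
      by (intro integral_mult_bounded[OF L.integrable_product_mult[OF e integrable_std_gaussian_inner[OF b]] _ B'])
        measurable
    have "integrable (lborel \<Otimes>\<^sub>M std_gaussian)
        (\<lambda>x. c * (((?e (fst x) * fst x ^ 1) * 1) * \<phi> (y + fst x *\<^sub>R (snd x :: 'a)))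
          - (\<Sum>b\<in>Basis. ((?e (fst x) * fst x ^ 0) * (snd x \<bullet> b)) * partial b \<phi> (y + fst x *\<^sub>R snd x)))"
      by (intro Bochner_Integration.integrable_diff integrable_mult_right 1 Bochner_Integration.integrable_sum 2)
    then show ?thesis
      by (rule Bochner_Integration.integrable_cong[OF refl, THEN iffD1, rotated])
        (simp add: case_prod_beta algebra_simps sum_distrib_left)
  qed
  have "(\<integral>x. ?\<psi> (y + x) \<partial>resolvent_law c)
      = (\<integral>x. ?\<psi> (y + fst x *\<^sub>R snd x) \<partial>(radial_law c \<Otimes>\<^sub>M std_gaussian))"
    unfolding resolvent_law_def by (subst integral_distr) auto
  also have "\<dots> = (\<integral>s. (\<integral>z. ?\<psi> (y + s *\<^sub>R z) \<partial>std_gaussian) \<partial>radial_law c)"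
  proof -
    have "integrable (radial_law c \<Otimes>\<^sub>M std_gaussian) (\<lambda>x. ?\<psi> (y + fst x *\<^sub>R (snd x :: 'a)))"
      by (rule P.integrable_const_bound[where B="B + Bl / c"]) (use B\<psi> in auto)
    from P.integral_fst'[OF this] show ?thesis by simp
  qed
  also have "\<dots> = (\<integral>s. ?e s * (c * s) * (\<integral>z. ?\<psi> (y + s *\<^sub>R z) \<partial>std_gaussian) \<partial>lborel)"
    unfolding radial_law_def
    by (subst integral_density) (auto simp: radial_density_nonneg[OF c])
  also have "\<dots> = (\<integral>s. (\<integral>z. ?H s z \<partial>std_gaussian) \<partial>lborel)"
    unfolding integral_mult_right_zero integral_gaussian_resolvent[OF \<phi> c, symmetric]
    by (simp only: mult.assoc)
  also have "\<dots> = (\<integral>z. (\<integral>s. ?H s z \<partial>lborel) \<partial>std_gaussian)"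
    by (rule L.Fubini_integral[OF intH, symmetric])
  also have "\<dots> = (\<integral>z. \<phi> y \<partial>(std_gaussian :: 'a measure))"
  proof (rule Bochner_Integration.integral_cong[OF refl])
    fix z :: 'a
    \<comment> \<open>The bound may depend on \<open>z\<close>, because the half-line formula is
      applied for one \<open>z\<close> at a time.\<close>
    have D: "\<bar>?D x z\<bar> \<le> (\<Sum>b\<in>Basis. \<bar>z \<bullet> b\<bar> * B' b)" for x
      by (rule sum_abs[THEN order_trans]) (auto intro!: sum_mono mult_left_mono B' simp: abs_mult)
    have "(\<integral>s. ?H s z \<partial>lborel) = \<phi> (y + 0 *\<^sub>R z)"
    proof (rule integral_half_line_gaussian(2)[OF c _ _ B D])
      show "((\<lambda>s. \<phi> (y + s *\<^sub>R z)) has_real_derivative ?D (y + s *\<^sub>R z) z) (at s)" for s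
        unfolding frechet_derivative_partial[OF test_function_differentiable[OF \<phi>], symmetric]
        by (intro frechet_derivative_real_affine test_function_differentiable \<phi>)
      show "continuous_on UNIV (\<lambda>s. ?D (y + s *\<^sub>R z) z)"
        by (intro continuous_intros continuous_on_compose2[OF test_function_continuous[OF test_function_partial[OF \<phi>]]]) auto
    qed
    then show "(\<integral>s. ?H s z \<partial>lborel) = \<phi> y" by simp
  qed
  finally show ?thesis by (simp add: std_gaussian.prob_space)
qed


section \<open>Convolution of bounded continuous functions with a probability measure\<close>

text \<open>Since \<open>N\<close> has mass 1, the constant \<open>norm h\<close> is an integrable
  majorant. It bounds the convolution and gives its continuity by dominated convergence.\<close>

lemma convolution_bcontfun:
  fixes h :: "'a::euclidean_space \<Rightarrow>\<^sub>C real"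
  assumes N: "prob_space N" "sets N = sets borel"
  shows "(\<lambda>y. \<integral>x. h (y - x) \<partial>N) \<in> bcontfun" and "\<bar>\<integral>x. h (y - x) \<partial>N\<bar> \<le> norm h"
    and "integrable N (\<lambda>x. h (y - x))"
proof -
  interpret prob_space N by fact
  note [measurable_cong] = N(2)
  have [measurable]: "apply_bcontfun h \<in> borel_measurable borel"
    by (intro borel_measurable_continuous_onI) simp
  have meas: "(\<lambda>x. h (y - x)) \<in> borel_measurable N" for y by measurable
  have bd: "\<bar>h x\<bar> \<le> norm h" for x using norm_bounded[of h x] by simp
  show int: "integrable N (\<lambda>x. h (y - x))" for y
    by (rule integrable_const_bound[where B="norm h"]) (use bd meas in auto)
  show le: "\<bar>\<integral>x. h (y - x) \<partial>N\<bar> \<le> norm h" for y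
  proof -
    have "\<bar>\<integral>x. h (y - x) \<partial>N\<bar> \<le> (\<integral>x. \<bar>h (y - x)\<bar> \<partial>N)" by (rule integral_abs_bound)
    also have "\<dots> \<le> (\<integral>x. norm h \<partial>N)" using int bd by (intro integral_mono) auto
    finally show ?thesis using prob_space by simp
  qed
  show "(\<lambda>y. \<integral>x. h (y - x) \<partial>N) \<in> bcontfun"
  proof (rule bcontfun_normI[where b="norm h"])
    show "continuous_on UNIV (\<lambda>y. \<integral>x. h (y - x) \<partial>N)"
      unfolding continuous_on_sequentially
    proof (intro ballI allI impI, elim conjE)
      fix t :: "nat \<Rightarrow> 'a" and a assume t: "t \<longlonglongrightarrow> a"
      show "((\<lambda>y. \<integral>x. h (y - x) \<partial>N) \<circ> t) \<longlonglongrightarrow> (\<integral>x. h (a - x) \<partial>N)"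
        unfolding comp_def
      proof (rule integral_dominated_convergence[where w="\<lambda>_. norm h"])
        show "AE x in N. (\<lambda>n. h (t n - x)) \<longlonglongrightarrow> h (a - x)"
        proof (rule AE_I2)
          show "(\<lambda>n. h (t n - x)) \<longlonglongrightarrow> h (a - x)" for x
            by (rule continuous_on_tendsto_compose[OF continuous_on_apply_bcontfun[of UNIV h]])
              (auto intro!: tendsto_intros t)
        qed
      qed (use meas bd in auto)
    qed
  qed (use le in simp)
qed

lemma integral_lborel_translation:
  fixes g :: "'a::euclidean_space \<Rightarrow> real"
  assumes [measurable]: "g \<in> borel_measurable borel"
  shows "(\<integral>y. g (x + y) \<partial>lborel) = (\<integral>y. g y \<partial>lborel)"
    and "integrable lborel (\<lambda>y. g (x + y)) \<longleftrightarrow> integrable lborel g"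
proof -
  show "(\<integral>y. g (x + y) \<partial>lborel) = (\<integral>y. g y \<partial>lborel)"
    by (subst (2) lborel_distr_plus[of x, symmetric]) (simp add: integral_distr)
  show "integrable lborel (\<lambda>y. g (x + y)) \<longleftrightarrow> integrable lborel g"
    by (subst (2) lborel_distr_plus[of x, symmetric]) (simp add: integrable_distr_eq)
qed

text \<open>Fubini and the substitution \<open>y = w + x\<close> move the convolution from
  \<open>h\<close> onto \<open>\<psi>\<close>, reflecting the kernel on the way. Hence
  \<open>h\<close> is evaluated at \<open>y - x\<close> but \<open>\<psi>\<close> at
  \<open>w + x\<close>, the form found in \<open>integral_resolvent_law\<close>.\<close>

lemma integral_convolution_swap:
  fixes h \<psi> :: "'a::euclidean_space \<Rightarrow> real"
  assumes N: "prob_space N" "sets N = sets borel"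
    and h [measurable]: "h \<in> borel_measurable borel" and B: "\<And>x. \<bar>h x\<bar> \<le> B"
    and \<psi>: "integrable lborel \<psi>"
  shows "(\<integral>y. (\<integral>x. h (y - x) \<partial>N) * \<psi> y \<partial>lborel) = (\<integral>w. h w * (\<integral>x. \<psi> (w + x) \<partial>N) \<partial>lborel)"
proof -
  interpret prob_space N by fact
  interpret P: pair_sigma_finite N "lborel :: 'a measure" ..
  note [measurable_cong] = N(2)
  have [measurable]: "\<psi> \<in> borel_measurable borel" using \<psi> by auto
  have B0: "0 \<le> B" using B[of 0] by linarith
  have translate: "(\<integral>y. \<bar>\<psi> (y + x)\<bar> \<partial>lborel) = (\<integral>y. \<bar>\<psi> y\<bar> \<partial>lborel)" "integrable lborel (\<lambda>y. \<psi> (y + x))" for x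
    using integral_lborel_translation(1)[of "\<lambda>y. \<bar>\<psi> y\<bar>" x] integral_lborel_translation(2)[of \<psi> x] \<psi>
    by (auto simp: add.commute)
  have int1: "integrable (N \<Otimes>\<^sub>M lborel) (\<lambda>(x, y). h (y - x) * \<psi> y)"
  proof -
    have "integrable (N \<Otimes>\<^sub>M lborel) (\<lambda>x. (1 * \<psi> (snd x)) * h (snd x - fst x))"
      by (intro integral_mult_bounded[OF P.integrable_product_mult[OF _ \<psi>] _ B]) auto
    then show ?thesis by (simp add: case_prod_beta' mult.commute)
  qed
  \<comment> \<open>By translation invariance the integral of
    \<open>\<bar>\<psi> (w + x)\<bar>\<close> over \<open>w\<close> is the same for all
    \<open>x\<close>, hence integrable over the probability measure \<open>N\<close>.\<close>
  have int2: "integrable (N \<Otimes>\<^sub>M lborel) (\<lambda>(x, w). h w * \<psi> (w + x))"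
  proof -
    have "integrable (N \<Otimes>\<^sub>M lborel) (\<lambda>x. \<psi> (snd x + fst x))"
    proof (rule P.Fubini_integrable)
      show "integrable N (\<lambda>x. \<integral>y. norm (\<psi> (snd (x, y) + fst (x, y))) \<partial>lborel)"
        by (simp add: translate)
      show "AE x in N. integrable lborel (\<lambda>y. \<psi> (snd (x, y) + fst (x, y)))"
        by (simp add: translate)
    qed measurable
    from integral_mult_bounded[OF this, of "\<lambda>x. h (snd x)" B]
    show ?thesis using B by (simp add: case_prod_beta' mult.commute)
  qed
  have "(\<integral>y. (\<integral>x. h (y - x) \<partial>N) * \<psi> y \<partial>lborel) = (\<integral>y. (\<integral>x. h (y - x) * \<psi> y \<partial>N) \<partial>lborel)"
    by simp
  also have "\<dots> = (\<integral>x. (\<integral>y. h (y - x) * \<psi> y \<partial>lborel) \<partial>N)"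
    by (rule P.Fubini_integral[OF int1])
  also have "\<dots> = (\<integral>x. (\<integral>w. h w * \<psi> (w + x) \<partial>lborel) \<partial>N)"
  proof (rule Bochner_Integration.integral_cong[OF refl])
    fix x
    show "(\<integral>y. h (y - x) * \<psi> y \<partial>lborel) = (\<integral>w. h w * \<psi> (w + x) \<partial>lborel)"
      using integral_lborel_translation(1)[of "\<lambda>y. h (y - x) * \<psi> y" x] by (simp add: add.commute)
  qed
  also have "\<dots> = (\<integral>w. (\<integral>x. h w * \<psi> (w + x) \<partial>N) \<partial>lborel)"
    by (rule P.Fubini_integral[OF int2, symmetric])
  finally show ?thesis by simp
qed

lemma bcontfun_test_integrable:
  fixes v :: "'a::euclidean_space \<Rightarrow>\<^sub>C real"
  assumes "integrable lborel \<phi>"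
  shows "integrable lborel (\<lambda>x. v x * \<phi> x)"
proof -
  have "apply_bcontfun v \<in> borel_measurable borel"
    by (intro borel_measurable_continuous_onI) simp
  then have "integrable lborel (\<lambda>x. \<phi> x * v x)"
    using norm_bounded[of v] by (intro integral_mult_bounded[OF assms, of _ "norm v"]) auto
  then show ?thesis by (simp add: mult.commute)
qed

section \<open>The resolvent as an operator on bounded continuous functions\<close>

text \<open>For \<open>c > 0\<close> this realizes the inverse of \<open>1 - \<Delta> / c\<close>,
  normalized so that constants are fixed and the norm is not increased.\<close>

definition resolvent :: "real \<Rightarrow> ('a::euclidean_space \<Rightarrow>\<^sub>C real) \<Rightarrow> 'a \<Rightarrow>\<^sub>C real" where
  "resolvent c h = Bcontfun (\<lambda>y. \<integral>x. h (y - x) \<partial>resolvent_law c)"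

lemma apply_resolvent:
  fixes h :: "'a::euclidean_space \<Rightarrow>\<^sub>C real"
  assumes "c > 0"
  shows "resolvent c h y = (\<integral>x. h (y - x) \<partial>resolvent_law c)"
  unfolding resolvent_def
  by (subst Bcontfun_inverse) (auto intro!: convolution_bcontfun prob_space_resolvent_law assms)

lemma norm_resolvent_le:
  fixes h :: "'a::euclidean_space \<Rightarrow>\<^sub>C real"
  assumes "c > 0"
  shows "norm (resolvent c h) \<le> norm h"
  by (intro norm_bound) (auto simp: apply_resolvent assms intro!: convolution_bcontfun(2) prob_space_resolvent_law)

lemma resolvent_diff:
  fixes h g :: "'a::euclidean_space \<Rightarrow>\<^sub>C real"
  assumes "c > 0"
  shows "resolvent c (h - g) = resolvent c h - resolvent c g"
  by (rule bcontfun_eqI)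
    (simp add: apply_resolvent assms convolution_bcontfun(3) prob_space_resolvent_law)

text \<open>The convolution is moved onto \<open>\<phi> - \<Delta>\<phi> / c\<close>, which the law
  maps back to \<open>\<phi>\<close>.\<close>

lemma resolvent_weak:
  fixes h :: "'a::euclidean_space \<Rightarrow>\<^sub>C real"
  assumes c: "c > 0" and \<phi>: "test_function \<phi>"
  shows "(\<integral>y. resolvent c h y * \<phi> y \<partial>lborel) - (\<integral>y. resolvent c h y * laplacian \<phi> y \<partial>lborel) / c
    = (\<integral>y. h y * \<phi> y \<partial>lborel)"
proof -
  let ?\<psi> = "\<lambda>x. \<phi> x - laplacian \<phi> x / c"
  have [simp]: "integrable lborel \<phi>" "integrable lborel (laplacian \<phi>)"
    by (intro test_function_integrable laplacian_integrable \<phi>)+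
  have \<psi>: "integrable lborel ?\<psi>" by simp
  have h: "apply_bcontfun h \<in> borel_measurable borel"
    by (intro borel_measurable_continuous_onI) simp
  have "(\<integral>y. resolvent c h y * \<phi> y \<partial>lborel) - (\<integral>y. resolvent c h y * laplacian \<phi> y \<partial>lborel) / c
      = (\<integral>y. resolvent c h y * \<phi> y - resolvent c h y * laplacian \<phi> y / c \<partial>lborel)"
    by (simp add: bcontfun_test_integrable)
  also have "\<dots> = (\<integral>y. resolvent c h y * ?\<psi> y \<partial>lborel)"
    by (simp add: algebra_simps)
  also have "\<dots> = (\<integral>w. h w * (\<integral>x. ?\<psi> (w + x) \<partial>resolvent_law c) \<partial>lborel)"
    unfolding apply_resolvent[OF c]
    by (rule integral_convolution_swap[OF prob_space_resolvent_law[OF c] _ h _ \<psi>, of "norm h"])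
      (use norm_bounded[of h] in auto)
  also have "\<dots> = (\<integral>y. h y * \<phi> y \<partial>lborel)"
    by (simp add: integral_resolvent_law[OF \<phi> c])
  finally show ?thesis .
qed

section \<open>Bounds for the nonlinear term\<close>

lemma smooth_real_deriv:
  assumes "smooth f"
  shows "(f has_real_derivative deriv f x) (at x)" and "continuous_on UNIV (deriv f)"
proof -
  have C1: "Ck (Suc 0) f" using assms by (simp add: smooth_def)
  show d: "(f has_real_derivative deriv f x) (at x)" for x
    using C1 by (auto simp: DERIV_deriv_iff_real_differentiable)
  have "deriv f x = frechet_derivative f (at x) 1" for x
    using d[of x] by (simp add: has_field_derivative_def flip: frechet_derivative_at)
  then show "continuous_on UNIV (deriv f)"
    using C1 by simp
qed

text \<open>Compactness of the interval makes the set of values bounded above, so that the real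
  supremum dominates each of them.\<close>

lemma le_max_abs:
  assumes g: "continuous_on UNIV g" and u: "\<bar>u\<bar> \<le> R"
  shows "\<bar>g u\<bar> \<le> max_abs g R"
  unfolding max_abs_def
proof (rule cSUP_upper)
  have "compact ((\<lambda>u. \<bar>g u\<bar>) ` {-R..R})"
    by (intro compact_continuous_image continuous_intros continuous_on_subset[OF g]) auto
  then show "bdd_above ((\<lambda>u. \<bar>g u\<bar>) ` {-R..R})"
    by (intro bounded_imp_bdd_above compact_imp_bounded)
qed (use u in auto)

text \<open>With \<open>q = a\<^sup>2 + p\<close> this is the right-hand side of the equation once
  only the constant-coefficient operator \<open>- \<epsilon>\<^sup>2 \<Delta> + a\<^sup>2\<close> is
  kept on the left.\<close>

definition nonlinearity :: "(real \<Rightarrow> real) \<Rightarrow> ('a::topological_space \<Rightarrow>\<^sub>C real) \<Rightarrow> ('a \<Rightarrow>\<^sub>C real) \<Rightarrow> 'a \<Rightarrow>\<^sub>C real" where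
  "nonlinearity f p u = Bcontfun (\<lambda>x. f (u x) - p x * u x)"

lemma apply_bcontfun_abs_le: "\<bar>apply_bcontfun v x\<bar> \<le> norm v" for v :: "_ \<Rightarrow>\<^sub>C real"
  using norm_bounded[of v x] by simp

text \<open>The values of \<open>u\<close> lie in the interval of radius \<open>norm u\<close>, on
  which the continuous \<open>f\<close> is bounded; so the function is bounded and
  \<open>Bcontfun\<close> represents it.\<close>

lemma apply_nonlinearity:
  assumes f: "continuous_on UNIV f"
  shows "nonlinearity f p u x = f (u x) - p x * u x"
  unfolding nonlinearity_def
proof (subst Bcontfun_inverse)
  show "(\<lambda>x. f (u x) - p x * u x) \<in> bcontfun"
  proof (rule bcontfun_normI)
    show "continuous_on UNIV (\<lambda>x. f (u x) - p x * u x)"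
      by (intro continuous_intros continuous_on_compose2[OF f]) auto
    show "norm (f (u x) - p x * u x) \<le> max_abs f (norm u) + norm p * norm u" for x
      unfolding real_norm_def using le_max_abs[OF f apply_bcontfun_abs_le, of u x]
      by (intro order_trans[OF abs_triangle_ineq4] add_mono)
        (auto simp: abs_mult intro!: mult_mono apply_bcontfun_abs_le)
  qed
qed simp

lemma norm_nonlinearity_le:
  assumes f: "continuous_on UNIV f" and u: "norm u \<le> R"
  shows "norm (nonlinearity f p u) \<le> norm p * R + max_abs f R"
proof (rule norm_bound)
  fix x
  have ux: "\<bar>u x\<bar> \<le> R" using apply_bcontfun_abs_le[of u x] u by linarith
  have "\<bar>p x * u x\<bar> \<le> norm p * R"
    unfolding abs_mult by (intro mult_mono apply_bcontfun_abs_le ux) auto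
  then show "norm (nonlinearity f p u x) \<le> norm p * R + max_abs f R"
    unfolding apply_nonlinearity[OF f] real_norm_def using le_max_abs[OF f ux] by linarith
qed

text \<open>At each point both values lie in the convex set \<open>{-R..R}\<close>, where the mean
  value inequality makes \<open>f\<close> Lipschitz with constant
  \<open>max_abs (deriv f) R\<close>.\<close>

lemma norm_nonlinearity_diff_le:
  assumes f: "smooth f" and u: "norm u \<le> R" and v: "norm v \<le> R"
  shows "norm (nonlinearity f p u - nonlinearity f p v) \<le> (norm p + max_abs (deriv f) R) * norm (u - v)"
proof (rule norm_bound)
  fix x
  note df = smooth_real_deriv[OF f]
  have cf: "continuous_on UNIV f" using f by (simp add: smooth_def) (metis Ck.simps(1))
  have ux: "\<bar>u x\<bar> \<le> R" and vx: "\<bar>v x\<bar> \<le> R"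
    using apply_bcontfun_abs_le[of u x] u apply_bcontfun_abs_le[of v x] v by linarith+
  have uv: "\<bar>u x - v x\<bar> \<le> norm (u - v)" using apply_bcontfun_abs_le[of "u - v" x] by simp
  have "norm (f (u x) - f (v x)) \<le> max_abs (deriv f) R * norm (u x - v x)"
  proof (rule field_differentiable_bound[of "{-R..R}"])
    show "(f has_field_derivative deriv f z) (at z within {-R..R})" for z
      by (rule has_field_derivative_at_within[OF df(1)])
    show "norm (deriv f z) \<le> max_abs (deriv f) R" if "z \<in> {-R..R}" for z
      using le_max_abs[OF df(2), of z R] that by auto
  qed (use ux vx in auto)
  also have "\<dots> \<le> max_abs (deriv f) R * norm (u - v)"
    \<comment> \<open>Bounding an absolute value at \<open>u x\<close> also shows that
      \<open>max_abs (deriv f) R\<close> is nonnegative, as monotonicity of the product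
      requires.\<close>
    using uv le_max_abs[OF df(2) ux] by (intro mult_left_mono) auto
  finally have "\<bar>f (u x) - f (v x)\<bar> \<le> max_abs (deriv f) R * norm (u - v)" by simp
  moreover have "\<bar>p x * (u x - v x)\<bar> \<le> norm p * norm (u - v)"
    unfolding abs_mult by (intro mult_mono apply_bcontfun_abs_le uv) auto
  ultimately show "norm ((nonlinearity f p u - nonlinearity f p v) x) \<le> (norm p + max_abs (deriv f) R) * norm (u - v)"
    by (simp add: apply_nonlinearity[OF cf] algebra_simps)
qed

section \<open>The contraction argument and the weak equation\<close>

theorem theorem1p1:
  fixes a R \<gamma> :: real
    and q p :: "(real ^ 3) \<Rightarrow>\<^sub>C real"
    and f :: "real \<Rightarrow> real"
  defines "p \<equiv> q - const_bcontfun (a\<^sup>2)"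
  assumes "a > 0"
    and "\<forall>x. apply_bcontfun q x \<ge> a\<^sup>2"
    and "smooth f"
    and "f 0 \<noteq> 0"
    and "R > 0"
    and "\<gamma> > 0"
    and "(norm p * R + max_abs f R) / a\<^sup>2 \<le> R"
    and "(norm p + max_abs (deriv f) R) / a\<^sup>2 \<le> \<gamma>"
    and "\<gamma> < 1"
  shows "\<forall>\<epsilon>>0. \<exists>u :: (real ^ 3) \<Rightarrow>\<^sub>C real.
    distributional_solution \<epsilon> (apply_bcontfun q) f (apply_bcontfun u) \<and>
    Bfun (apply_bcontfun u) at_infinity \<and>
    (\<exists>x. apply_bcontfun u x \<noteq> 0)"
proof (intro allI impI)
  fix \<epsilon> :: real assume \<epsilon>: "\<epsilon> > 0"
  \<comment> \<open>Dividing \<open>- \<epsilon>\<^sup>2 \<Delta> + a\<^sup>2\<close> by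
    \<open>a\<^sup>2\<close> leaves \<open>1 - \<Delta> / c\<close> for this \<open>c\<close>. The
    inverse is thus \<open>1 / a\<^sup>2\<close> times the resolvent, a factor independent of
    \<epsilon>, so the same \<open>R\<close> and \<gamma> serve every \<epsilon>.\<close>
  define c where "c = a\<^sup>2 / \<epsilon>\<^sup>2"
  have c: "c > 0" using \<epsilon> \<open>a > 0\<close> by (simp add: c_def)
  have a2: "a\<^sup>2 > 0" using \<open>a > 0\<close> by simp
  have cf: "continuous_on UNIV f" using \<open>smooth f\<close> by (simp add: smooth_def) (metis Ck.simps(1))
  define S where "S u = (1 / a\<^sup>2) *\<^sub>R resolvent c (nonlinearity f p u)" for u
  have "\<exists>!u\<in>cball 0 R. S u = u"
  proof (rule Banach_fix[OF complete_eq_closed[THEN iffD2, OF closed_cball]])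
    show "cball (0 :: (real ^ 3) \<Rightarrow>\<^sub>C real) R \<noteq> {}" using \<open>R > 0\<close> by simp
    show "S ` cball 0 R \<subseteq> cball 0 R"
    proof (intro image_subsetI)
      fix u :: "(real ^ 3) \<Rightarrow>\<^sub>C real" assume "u \<in> cball 0 R"
      then have "norm u \<le> R" by simp
      from order_trans[OF norm_resolvent_le[OF c] norm_nonlinearity_le[OF cf this]]
      have "norm (S u) \<le> (norm p * R + max_abs f R) / a\<^sup>2"
        by (simp add: S_def divide_right_mono)
      then show "S u \<in> cball 0 R"
        using \<open>(norm p * R + max_abs f R) / a\<^sup>2 \<le> R\<close> by simp
    qed
    fix u v :: "(real ^ 3) \<Rightarrow>\<^sub>C real" assume "u \<in> cball 0 R" "v \<in> cball 0 R"
    then have uv: "norm u \<le> R" "norm v \<le> R" by simp_all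
    have "dist (S u) (S v) = norm (resolvent c (nonlinearity f p u - nonlinearity f p v)) / a\<^sup>2"
      by (simp add: dist_norm S_def resolvent_diff[OF c] flip: scaleR_diff_right)
    also have "\<dots> \<le> (norm p + max_abs (deriv f) R) * norm (u - v) / a\<^sup>2"
      by (intro divide_right_mono order_trans[OF norm_resolvent_le[OF c]]
          norm_nonlinearity_diff_le \<open>smooth f\<close> uv) simp
    also have "\<dots> = (norm p + max_abs (deriv f) R) / a\<^sup>2 * norm (u - v)" by simp
    also have "\<dots> \<le> \<gamma> * norm (u - v)"
      by (intro mult_right_mono \<open>(norm p + max_abs (deriv f) R) / a\<^sup>2 \<le> \<gamma>\<close>) simp
    finally show "dist (S u) (S v) \<le> \<gamma> * dist u v" by (simp add: dist_norm)
  qed (use \<open>\<gamma> > 0\<close> \<open>\<gamma> < 1\<close> in auto)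
  then obtain u where u: "S u = u" by blast
  let ?h = "nonlinearity f p u"
  have Su: "resolvent c ?h x = a\<^sup>2 * u x" for x
    using arg_cong[OF u, of "\<lambda>v. v x"] a2 by (simp add: S_def field_simps)
  have "distributional_solution \<epsilon> q f u"
    unfolding distributional_solution_def
  proof (intro allI impI)
    fix \<phi> :: "real ^ 3 \<Rightarrow> real" assume \<phi>: "test_function \<phi>"
    have int: "integrable lborel \<phi>" by (rule test_function_integrable[OF \<phi>])
    have "?h x * \<phi> x + q x * u x * \<phi> x = f (u x) * \<phi> x + a\<^sup>2 * (u x * \<phi> x)" for x
      by (simp add: apply_nonlinearity[OF cf] p_def algebra_simps)
    then have f: "f (u x) * \<phi> x = ?h x * \<phi> x + q x * (u x * \<phi> x) - a\<^sup>2 * (u x * \<phi> x)" for x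
      by (simp add: algebra_simps)
    have "(\<integral>x. f (u x) * \<phi> x \<partial>lborel)
        = (\<integral>x. ?h x * \<phi> x \<partial>lborel) + (\<integral>x. q x * (u x * \<phi> x) \<partial>lborel) - a\<^sup>2 * (\<integral>x. u x * \<phi> x \<partial>lborel)"
      unfolding f by (simp add: bcontfun_test_integrable int)
    \<comment> \<open>The weak resolvent identity for \<open>?h\<close>, whose image is
      \<open>a\<^sup>2\<close> times \<open>u\<close>, with
      \<open>1 / c = \<epsilon>\<^sup>2 / a\<^sup>2\<close>.\<close>
    moreover have "a\<^sup>2 * (\<integral>x. u x * \<phi> x \<partial>lborel) - \<epsilon>\<^sup>2 * (\<integral>x. u x * laplacian \<phi> x \<partial>lborel) = (\<integral>x. ?h x * \<phi> x \<partial>lborel)"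
      using resolvent_weak[OF c \<phi>, of ?h, unfolded Su mult.assoc integral_mult_right_zero] a2 \<epsilon>
      by (simp add: c_def field_simps)
    ultimately show "- \<epsilon>\<^sup>2 * (\<integral>x. u x * laplacian \<phi> x \<partial>lborel) + (\<integral>x. q x * u x * \<phi> x \<partial>lborel)
        = (\<integral>x. f (u x) * \<phi> x \<partial>lborel)"
      by (simp add: mult.assoc)
  qed
  moreover have "Bfun u at_infinity"
    by (rule BfunI[of _ "norm u"]) (simp add: apply_bcontfun_abs_le)
  moreover have "\<exists>x. u x \<noteq> 0"
  proof (rule ccontr)
    assume "\<not> ?thesis"
    then have u0: "u x = 0" for x by simp
    interpret prob_space "resolvent_law c :: (real ^ 3) measure" by (rule prob_space_resolvent_law[OF c])
    \<comment> \<open>For \<open>u = 0\<close> the function \<open>?h\<close> is the constant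
      \<open>f 0\<close>, which averaging against a probability measure preserves; the fixed point
      equation would make this value 0.\<close>
    have "resolvent c ?h 0 = f 0"
      by (simp add: apply_resolvent[OF c] apply_nonlinearity[OF cf] u0 prob_space)
    then show False using Su[of 0] u0 \<open>f 0 \<noteq> 0\<close> by simp
  qed
  ultimately show "\<exists>u :: (real ^ 3) \<Rightarrow>\<^sub>C real. distributional_solution \<epsilon> q f u \<and> Bfun u at_infinity \<and> (\<exists>x. u x \<noteq> 0)"
    by blast
qed

end
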